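(* Let $X$ be a Banach space admitting an equivalent norm with property $(\beta_p)$ for some $p\in(1,\infty)$. Assume that a Banach space $Y$ is a coarse subquotient of $X$, where the coarse quotient map is Lipschitz for large distances (i.e. there are a subset $Z\subset X$ and a coarse quotient map $f\colon Z\to Y$ that is Lipschitz for large distances). Then for any $q\in(p,\infty)$, $\ell_q$ is not a coarse subquotient of $Y$ via a coarse quotient map that is Lipschitz for large distances (i.e. there are no subset $S\subset Y$ and coarse quotient map $g\colon S\to\ell_q$ that is Lipschitz for large distances).
   Context: All metric spaces are nonempty and $B_M(x,r)$ denotes the closed ball of a metric space $M$. For a subset $A$ of a metric space $N$ and $K\ge0$, $A^K:=\{y\in N: d_N(y,z)\le K\text{ for some }z\in A\}$. A map $f\colon M\to N$ between metric spaces is coarsely continuous if $\omega_f(t):=\sup\{d_N(f(x),f(y)): d_M(x,y)\le t\}<\infty$ for all $t>0$. It is co-coarsely continuous with constant $K\in[0,\infty)$ if for every $\varepsilon>0$ there is $\delta=\delta(\varepsilon)>0$ such that for every $x\in M$, $B_N(f(x),\varepsilon)\subset f(B_M(x,\delta))^K$. $f$ is a coarse quotient map (with constant $K$) if it is coarsely continuous and co-coarsely continuous (with constant $K$, for some $K\in[0,\infty)$). $N$ is a coarse subquotient of $M$ if there is a coarse quotient map from a subset of $M$ to $N$. A map $f\colon M\to N$ is Lipschitz for large distances if for every $s\in(0,\infty)$ there is $L\in(0,\infty)$ (depending on $s$) such that $f(B_M(x,r))\subset B_N(f(x),Lr)$ for all $r\ge s$ and $x\in M$. For a Banach space $X$ with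 closed unit ball $B_X$ and a sequence $(y_i)$, put $\mathrm{sep}(\{y_i\}_{i=1}^\infty)=\inf\{\|y_n-y_m\|: n\ne m\}$ and $$\bar\beta_X(t)=1-\sup\left\{\inf_{i\ge1}\frac{\|x-y_i\|}{2}\colon x\in B_X,\ (y_i)_{i=1}^\infty\subset B_X,\ \mathrm{sep}(\{y_i\})\ge t\right\},$$ defined on an interval $[0,a]$ (those $t$ for which such sequences exist), where $a\in[1,2]$ depends on $X$. $X$ has property $(\beta_p)$ if there is $\gamma\in(0,\infty)$ with $\bar\beta_X(t)\ge\gamma t^p$ for all $t\in[0,a]$. *)

theory Defs
  imports "HOL-Analysis.Analysis"
begin

section \<open>Coarse quotient maps\<close>

text \<open>
  A metric space is given by its carrier and its distance function, as in the locale
  \<^locale>\<open>Metric_space\<close>; closed balls are \<^const>\<open>Metric_space.mcball\<close>. A subset of a metric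
  space is the smaller carrier with the same distance function.
\<close>

definition coarse_modulus ::
  "'a set \<Rightarrow> ('a \<Rightarrow> 'a \<Rightarrow> real) \<Rightarrow> ('b \<Rightarrow> 'b \<Rightarrow> real) \<Rightarrow> ('a \<Rightarrow> 'b) \<Rightarrow> real \<Rightarrow> ereal" where
  "coarse_modulus M d e f t =
     (SUP (x, y) \<in> {(x, y). x \<in> M \<and> y \<in> M \<and> d x y \<le> t}. ereal (e (f x) (f y)))"

definition coarsely_continuous ::
  "'a set \<Rightarrow> ('a \<Rightarrow> 'a \<Rightarrow> real) \<Rightarrow> ('b \<Rightarrow> 'b \<Rightarrow> real) \<Rightarrow> ('a \<Rightarrow> 'b) \<Rightarrow> bool" where
  "coarsely_continuous M d e f \<longleftrightarrow> (\<forall>t>0. coarse_modulus M d e f t < \<infinity>)"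

definition thickening :: "'b set \<Rightarrow> ('b \<Rightarrow> 'b \<Rightarrow> real) \<Rightarrow> 'b set \<Rightarrow> real \<Rightarrow> 'b set" where
  "thickening N e A K = {y \<in> N. \<exists>z\<in>A. e y z \<le> K}"

definition co_coarsely_continuous ::
  "'a set \<Rightarrow> ('a \<Rightarrow> 'a \<Rightarrow> real) \<Rightarrow> 'b set \<Rightarrow> ('b \<Rightarrow> 'b \<Rightarrow> real) \<Rightarrow> ('a \<Rightarrow> 'b) \<Rightarrow> real \<Rightarrow> bool" where
  "co_coarsely_continuous M d N e f K \<longleftrightarrow>
     (\<forall>\<epsilon>>0. \<exists>\<delta>>0. \<forall>x\<in>M.
        Metric_space.mcball N e (f x) \<epsilon> \<subseteq> thickening N e (f ` Metric_space.mcball M d x \<delta>) K)"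

text \<open>
  Metric spaces are nonempty by convention. For the domain this has to be required explicitly:
  otherwise every space would be a coarse quotient of the empty set.
\<close>

definition coarse_quotient_map ::
  "'a set \<Rightarrow> ('a \<Rightarrow> 'a \<Rightarrow> real) \<Rightarrow> 'b set \<Rightarrow> ('b \<Rightarrow> 'b \<Rightarrow> real) \<Rightarrow> ('a \<Rightarrow> 'b) \<Rightarrow> bool" where
  "coarse_quotient_map M d N e f \<longleftrightarrow>
     M \<noteq> {} \<and> f \<in> M \<rightarrow> N \<and> coarsely_continuous M d e f \<and>
     (\<exists>K\<ge>0. co_coarsely_continuous M d N e f K)"

definition lipschitz_for_large_distances ::
  "'a set \<Rightarrow> ('a \<Rightarrow> 'a \<Rightarrow> real) \<Rightarrow> 'b set \<Rightarrow> ('b \<Rightarrow> 'b \<Rightarrow> real) \<Rightarrow> ('a \<Rightarrow> 'b) \<Rightarrow> bool" where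
  "lipschitz_for_large_distances M d N e f \<longleftrightarrow>
     (\<forall>s>0. \<exists>L>0. \<forall>r\<ge>s. \<forall>x\<in>M.
        f ` Metric_space.mcball M d x r \<subseteq> Metric_space.mcball N e (f x) (L * r))"


section \<open>Equivalent norms and property \<open>(\<beta>\<^sub>p)\<close>\<close>

definition equivalent_norm :: "('a::real_normed_vector \<Rightarrow> real) \<Rightarrow> bool" where
  "equivalent_norm \<nu> \<longleftrightarrow>
     (\<forall>x. \<nu> x = 0 \<longleftrightarrow> x = 0) \<and>
     (\<forall>c x. \<nu> (c *\<^sub>R x) = \<bar>c\<bar> * \<nu> x) \<and>
     (\<forall>x y. \<nu> (x + y) \<le> \<nu> x + \<nu> y) \<and>
     (\<exists>a>0. \<exists>b>0. \<forall>x. a * norm x \<le> \<nu> x \<and> \<nu> x \<le> b * norm x)"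

definition sep :: "('a::real_vector \<Rightarrow> real) \<Rightarrow> (nat \<Rightarrow> 'a) \<Rightarrow> real" where
  "sep \<nu> y = (INF (n, m) \<in> {(n, m). n \<noteq> m}. \<nu> (y n - y m))"

definition separated_ball_seqs :: "('a::real_vector \<Rightarrow> real) \<Rightarrow> real \<Rightarrow> (nat \<Rightarrow> 'a) set" where
  "separated_ball_seqs \<nu> t = {y. (\<forall>i. \<nu> (y i) \<le> 1) \<and> sep \<nu> y \<ge> t}"

definition beta_modulus_domain :: "('a::real_vector \<Rightarrow> real) \<Rightarrow> real set" where
  "beta_modulus_domain \<nu> = {t. 0 \<le> t \<and> separated_ball_seqs \<nu> t \<noteq> {}}"

text \<open>
  For a norm \<open>\<nu>\<close> all the real suprema and infima involved are bounded; the outer supremum is over a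
  nonempty set, hence meaningful, exactly for \<open>t\<close> admitting a sequence as above.
\<close>

definition beta_modulus :: "('a::real_vector \<Rightarrow> real) \<Rightarrow> real \<Rightarrow> real" where
  "beta_modulus \<nu> t =
     1 - (SUP (x, y) \<in> {x. \<nu> x \<le> 1} \<times> separated_ball_seqs \<nu> t. INF i. \<nu> (x - y i) / 2)"

definition property_beta :: "('a::real_vector \<Rightarrow> real) \<Rightarrow> real \<Rightarrow> bool" where
  "property_beta \<nu> p \<longleftrightarrow>
     (\<exists>\<gamma>>0. \<forall>t\<in>beta_modulus_domain \<nu>. beta_modulus \<nu> t \<ge> \<gamma> * t powr p)"


section \<open>The sequence space \<open>\<ell>\<^sub>q\<close>\<close>

definition lq_space :: "real \<Rightarrow> (nat \<Rightarrow> real) set" where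
  "lq_space q = {x. summable (\<lambda>i. \<bar>x i\<bar> powr q)}"

definition lq_norm :: "real \<Rightarrow> (nat \<Rightarrow> real) \<Rightarrow> real" where
  "lq_norm q x = (\<Sum>i. \<bar>x i\<bar> powr q) powr (1 / q)"

definition lq_dist :: "real \<Rightarrow> (nat \<Rightarrow> real) \<Rightarrow> (nat \<Rightarrow> real) \<Rightarrow> real" where
  "lq_dist q x y = lq_norm q (\<lambda>i. x i - y i)"

end

theory Submission
  imports Defs
begin

text \<open>
  Suppose that \<open>\<ell>\<^sub>q\<close> is a coarse subquotient of \<open>Y\<close> and \<open>Y\<close> is one of \<open>X\<close>. By
  \<open>coarse_subquotient_trans\<close> there are a subset \<open>Z\<close> of \<open>X\<close> and a co-coarsely continuous map
  \<open>h: Z \<rightarrow> \<ell>\<^sub>q\<close> that is Lipschitz for large distances, and it is enough to refute this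
  (\<open>lq_not_coarse_subquotient_of_beta\<close>).

  Because \<open>\<ell>\<^sub>q\<close> is geodesic, \<open>h\<close> is co-Lipschitz for large distances: every displacement of length
  \<open>r \<ge> 1\<close> in \<open>\<ell>\<^sub>q\<close> can be lifted to \<open>Z\<close> at cost \<open>C * r\<close> up to a bounded error
  (\<open>co_lipschitz_for_large_distances\<close>). On the other hand, the Lipschitz condition with constant \<open>L\<close>
  bounds the cost from below by roughly \<open>r / L\<close>. The contradiction comes from showing that the
  cost per unit length can be made arbitrarily small.

  Lift a displacement in two halves, but in the second half make, in addition, a detour of relative
  size \<open>t\<close> along a unit vector \<open>e\<^sub>n\<close> with \<open>n\<close> large. In \<open>\<ell>\<^sub>q\<close> this lengthens the path by a factor of only
  \<open>(1 + t\<^sup>q)\<^bsup>1/q\<^esup>\<close>. The lifts for different \<open>n\<close> form a fork in \<open>X\<close> with a common root and centre; its tips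
  are separated in proportion to \<open>t\<close>, since their images are. Property \<open>(\<beta>\<^sub>p)\<close> says that one of the tips
  is closer to the root by a factor \<open>1 - A * t\<^sup>p\<close> than the triangle inequality predicts
  (\<open>property_beta_fork\<close>). As \<open>p < q\<close>, for small \<open>t\<close> the saving outweighs the extra length
  (\<open>gain_beats_loss\<close>), and the doubled displacement has been lifted at a cost per unit length that is
  smaller by a fixed factor \<open>\<theta> < 1\<close> (\<open>tracks_double\<close>). Iterating drives this cost to \<open>0\<close>.

  The price is that the lifted point ends in the right place only up to detours in far
  coordinates. This does no harm, because only finitely many coordinates are ever inspected, and a
  single one suffices for the lower bound.
\<close>


section \<open>The metric space \<open>\<ell>\<^sub>q\<close>\<close>

lemma lq_norm_nonneg [simp]: "0 \<le> lq_norm q x"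
  by (simp add: lq_norm_def)

lemma lq_norm_powr:
  assumes "x \<in> lq_space q" "0 < q"
  shows "lq_norm q x powr q = (\<Sum>i. \<bar>x i\<bar> powr q)"
  using assms by (simp add: lq_norm_def powr_powr suminf_nonneg lq_space_def)

lemma lq_norm_le_iff:
  assumes "x \<in> lq_space q" "0 < q" "0 \<le> A"
  shows "lq_norm q x \<le> A \<longleftrightarrow> (\<Sum>i. \<bar>x i\<bar> powr q) \<le> A powr q"
  unfolding lq_norm_powr[OF assms(1,2), symmetric]
  using assms powr_mono2[of q "lq_norm q x" A] powr_less_mono2[of q A "lq_norm q x"]
  by (auto simp: not_le[symmetric])

lemma abs_coord_le_lq_norm:
  assumes "x \<in> lq_space q" "0 < q"
  shows "\<bar>x i\<bar> \<le> lq_norm q x"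
proof -
  have "\<bar>x i\<bar> powr q \<le> (\<Sum>j. \<bar>x j\<bar> powr q)"
    using assms sum_le_suminf[of "\<lambda>j. \<bar>x j\<bar> powr q" "{i}"] by (simp add: lq_space_def)
  also have "\<dots> = lq_norm q x powr q"
    using assms by (simp add: lq_norm_powr)
  finally show ?thesis
    using assms(2) by (metis lq_norm_nonneg not_le powr_less_mono2)
qed

lemma lq_coord_tendsto_0:
  assumes "x \<in> lq_space q" "0 < q"
  shows "x \<longlonglongrightarrow> 0"
proof -
  have "(\<lambda>i. \<bar>x i\<bar> powr q) \<longlonglongrightarrow> 0"
    using assms by (simp add: lq_space_def summable_LIMSEQ_zero)
  then have "(\<lambda>i. (\<bar>x i\<bar> powr q) powr (1 / q)) \<longlonglongrightarrow> 0"
    by (rule tendsto_zero_powrI[OF _ tendsto_const]) (use assms in auto)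
  then show ?thesis
    using assms by (simp add: powr_powr tendsto_rabs_zero_iff)
qed

lemma lq_space_scale:
  assumes "x \<in> lq_space q"
  shows "(\<lambda>i. c * x i) \<in> lq_space q"
  using assms by (simp add: lq_space_def abs_mult powr_mult summable_mult)

lemma lq_norm_scale:
  assumes "x \<in> lq_space q" "0 < q"
  shows "lq_norm q (\<lambda>i. c * x i) = \<bar>c\<bar> * lq_norm q x"
proof -
  have "(\<lambda>i. \<bar>c * x i\<bar> powr q) sums (\<bar>c\<bar> powr q * (\<Sum>i. \<bar>x i\<bar> powr q))"
    unfolding abs_mult powr_mult
    using assms by (intro sums_mult summable_sums) (simp add: lq_space_def)
  then show ?thesis
    using assms(2) by (simp add: lq_norm_def sums_iff powr_mult powr_powr)
qed

lemma powr_convex_nonneg: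
  fixes a b s q :: real
  assumes "1 \<le> q" "0 \<le> a" "0 \<le> b" "0 \<le> s" "s \<le> 1"
  shows "(s * a + (1 - s) * b) powr q \<le> s * a powr q + (1 - s) * b powr q"
proof -
  have powr_le: "u powr q \<le> u" if "0 \<le> u" "u \<le> 1" for u :: real
    using that assms(1) powr_mono'[of 1 q u] by simp
  consider "a = 0" | "b = 0" | "0 < a" "0 < b" using assms by force
  then show ?thesis
  proof cases
    case 1
    then show ?thesis
      using powr_le[of "1 - s"] assms by (simp add: powr_mult mult_right_mono)
  next
    case 2
    then show ?thesis
      using powr_le[of s] assms by (simp add: powr_mult mult_right_mono)
  next
    case 3
    then show ?thesis
      using convex_onD[OF powr_convex[OF assms(1)], of "1 - s" a b] assms by simp
  qed
qed

text \<open>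
  The triangle inequality comes from convexity of \<open>u \<mapsto> u\<^sup>q\<close>: the coordinates of \<open>(x + y) / (A + B)\<close> are
  the convex combinations of those of \<open>x / A\<close> and \<open>y / B\<close> with weights \<open>A / (A + B)\<close> and \<open>B / (A + B)\<close>.
  Bounds \<open>A\<close>, \<open>B\<close> in place of the norms themselves keep the denominators positive.
\<close>

lemma lq_add_bound:
  assumes q: "1 \<le> q" and x: "x \<in> lq_space q" and y: "y \<in> lq_space q"
    and A: "0 < A" "lq_norm q x \<le> A" and B: "0 < B" "lq_norm q y \<le> B"
  shows "(\<lambda>i. x i + y i) \<in> lq_space q" and "lq_norm q (\<lambda>i. x i + y i) \<le> A + B"
proof -
  define s where "s = A / (A + B)"
  have s: "0 \<le> s" "s \<le> 1" "1 - s = B / (A + B)"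
    using A B by (auto simp: s_def field_simps)
  define g where "g = (\<lambda>i. (A + B) powr q *
      (s * (\<bar>x i\<bar> powr q / A powr q) + (1 - s) * (\<bar>y i\<bar> powr q / B powr q)))"
  have le: "\<bar>x i + y i\<bar> powr q \<le> g i" for i
  proof -
    have "\<bar>x i\<bar> + \<bar>y i\<bar> = (A + B) * (s * (\<bar>x i\<bar> / A) + (1 - s) * (\<bar>y i\<bar> / B))"
    proof -
      have "(A + B) * s = A" "(A + B) * (1 - s) = B"
        unfolding s(3) using A B by (simp_all add: s_def)
      then have "(A + B) * s * (\<bar>x i\<bar> / A) + (A + B) * (1 - s) * (\<bar>y i\<bar> / B) = \<bar>x i\<bar> + \<bar>y i\<bar>"
        using A B by simp
      then show ?thesis by (simp only: distrib_left mult.assoc)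
    qed
    then have "\<bar>x i + y i\<bar> powr q
        \<le> ((A + B) * (s * (\<bar>x i\<bar> / A) + (1 - s) * (\<bar>y i\<bar> / B))) powr q"
      using q by (metis abs_ge_zero abs_triangle_ineq powr_mono2 order_trans zero_le_one)
    also have "\<dots> = (A + B) powr q * (s * (\<bar>x i\<bar> / A) + (1 - s) * (\<bar>y i\<bar> / B)) powr q"
      using A B s by (intro powr_mult) 
    also have "\<dots> \<le> (A + B) powr q * (s * (\<bar>x i\<bar> / A) powr q + (1 - s) * (\<bar>y i\<bar> / B) powr q)"
      using A B s q by (intro mult_left_mono powr_convex_nonneg) auto
    also have "\<dots> = g i"
      using A B by (simp add: g_def powr_divide)
    finally show ?thesis .
  qed
  have sx: "summable (\<lambda>i. \<bar>x i\<bar> powr q)" and sy: "summable (\<lambda>i. \<bar>y i\<bar> powr q)"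
    using x y by (auto simp: lq_space_def)
  have gs: "g sums ((A + B) powr q *
      (s * ((\<Sum>i. \<bar>x i\<bar> powr q) / A powr q) + (1 - s) * ((\<Sum>i. \<bar>y i\<bar> powr q) / B powr q)))"
    unfolding g_def by (intro sums_mult sums_add sums_divide summable_sums sx sy)
  then have sg: "summable g" by (rule sums_summable)
  show mem: "(\<lambda>i. x i + y i) \<in> lq_space q"
    unfolding lq_space_def mem_Collect_eq
    by (rule summable_comparison_test'[OF sg, of 0]) (use le in auto)
  have "(\<Sum>i. \<bar>x i + y i\<bar> powr q) \<le> suminf g"
    using mem sg le by (intro suminf_le) (auto simp: lq_space_def)
  also have "suminf g = (A + B) powr q *
      (s * ((\<Sum>i. \<bar>x i\<bar> powr q) / A powr q) + (1 - s) * ((\<Sum>i. \<bar>y i\<bar> powr q) / B powr q))"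
    by (rule sums_unique[OF gs, symmetric])
  also have "\<dots> \<le> (A + B) powr q * (s * 1 + (1 - s) * 1)"
    using A B s q lq_norm_le_iff[OF x, of A] lq_norm_le_iff[OF y, of B]
    by (intro mult_left_mono add_mono) (auto simp: field_simps)
  finally have "(\<Sum>i. \<bar>x i + y i\<bar> powr q) \<le> (A + B) powr q" by simp
  then show "lq_norm q (\<lambda>i. x i + y i) \<le> A + B"
    using A B q mem by (subst lq_norm_le_iff) auto
qed

lemma lq_space_add:
  assumes "1 \<le> q" "x \<in> lq_space q" "y \<in> lq_space q"
  shows "(\<lambda>i. x i + y i) \<in> lq_space q"
  using lq_add_bound(1)[OF assms, of "lq_norm q x + 1" "lq_norm q y + 1"]
  by (simp add: add_nonneg_pos)

lemma lq_space_diff: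
  assumes "1 \<le> q" "x \<in> lq_space q" "y \<in> lq_space q"
  shows "(\<lambda>i. x i - y i) \<in> lq_space q"
  using lq_space_add[OF assms(1,2) lq_space_scale[OF assms(3), of "-1"]] by simp

lemma lq_norm_triangle:
  assumes "1 \<le> q" "x \<in> lq_space q" "y \<in> lq_space q"
  shows "lq_norm q (\<lambda>i. x i + y i) \<le> lq_norm q x + lq_norm q y"
proof (rule field_le_epsilon)
  fix e :: real
  assume "0 < e"
  then show "lq_norm q (\<lambda>i. x i + y i) \<le> lq_norm q x + lq_norm q y + e"
    using lq_add_bound(2)[OF assms, of "lq_norm q x + e / 2" "lq_norm q y + e / 2"]
      lq_norm_nonneg[of q x] lq_norm_nonneg[of q y] by linarith
qed

lemma Metric_space_lq:
  assumes q: "1 \<le> q"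
  shows "Metric_space (lq_space q) (lq_dist q)"
proof
  fix x y z :: "nat \<Rightarrow> real"
  show "0 \<le> lq_dist q x y"
    by (simp add: lq_dist_def)
  show "lq_dist q x y = lq_dist q y x"
    by (simp add: lq_dist_def lq_norm_def abs_minus_commute)
  assume x: "x \<in> lq_space q" and y: "y \<in> lq_space q"
  have "x i = y i" if "lq_dist q x y = 0" for i
    using abs_coord_le_lq_norm[OF lq_space_diff[OF q x y], of i] that q by (simp add: lq_dist_def)
  moreover have "lq_dist q x x = 0"
    by (simp add: lq_dist_def lq_norm_def)
  ultimately show "lq_dist q x y = 0 \<longleftrightarrow> x = y"
    by blast
  assume z: "z \<in> lq_space q"
  show "lq_dist q x z \<le> lq_dist q x y + lq_dist q y z"
    using lq_norm_triangle[OF q lq_space_diff[OF q x y] lq_space_diff[OF q y z]]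
    by (simp add: lq_dist_def)
qed

text \<open>
  Vectors with disjoint supports add like \<open>q\<close>-th powers. This is the only feature of the norm of
  \<open>\<ell>\<^sub>q\<close> that ties the argument to the exponent \<open>q\<close>: moving aside by a small \<open>s\<close> lengthens a path by a
  term of order \<open>s\<^sup>q\<close> only.
\<close>

lemma lq_norm_powr_fun_upd:
  assumes q: "0 < q" and v: "v \<in> lq_space q" "v n = 0"
  shows "lq_norm q (v(n := s)) powr q = lq_norm q v powr q + \<bar>s\<bar> powr q"
proof -
  have eq: "\<bar>(v(n := s)) i\<bar> powr q = \<bar>v i\<bar> powr q + (if i = n then \<bar>s\<bar> powr q else 0)" for i
    using v q by simp
  have sums: "(\<lambda>i. \<bar>(v(n := s)) i\<bar> powr q) sums ((\<Sum>i. \<bar>v i\<bar> powr q) + \<bar>s\<bar> powr q)"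
    unfolding eq using v by (intro sums_add summable_sums sums_single) (simp add: lq_space_def)
  then have "v(n := s) \<in> lq_space q"
    by (auto simp: lq_space_def sums_iff)
  then show ?thesis
    using sums v q by (simp add: lq_norm_powr sums_iff)
qed

lemma finite_support_in_lq_space:
  assumes "finite {i. v i \<noteq> 0}"
  shows "v \<in> lq_space q"
  using assms unfolding lq_space_def
  by (intro CollectI summable_finite[of "{i. v i \<noteq> 0}"]) auto

text \<open>
  \<open>\<ell>\<^sub>q\<close> is a geodesic space; this is what allows a large distance to be covered in steps of a fixed
  length.
\<close>

lemma lq_segment:
  assumes q: "1 \<le> q" and a: "a \<in> lq_space q" and b: "b \<in> lq_space q"
    and s: "0 \<le> s" "s \<le> lq_dist q a b"
  obtains c where "c \<in> lq_space q" "lq_dist q a c = s" "lq_dist q c b = lq_dist q a b - s"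
proof (cases "lq_dist q a b = 0")
  case True
  then show ?thesis
    using that[of a] a s Metric_space.mdist_zero[OF Metric_space_lq[OF q] a] by auto
next
  case False
  define D where "D = lq_dist q a b"
  define l where "l = s / D"
  have D: "0 < D" using False s by (simp add: D_def)
  have l: "0 \<le> l" "l \<le> 1" using s D by (simp_all add: l_def D_def)
  have ab: "(\<lambda>i. a i - b i) \<in> lq_space q"
    by (rule lq_space_diff[OF q a b])
  define c where "c = (\<lambda>i. a i - l * (a i - b i))"
  have "c \<in> lq_space q"
    unfolding c_def by (intro lq_space_diff[OF q a] lq_space_scale ab)
  moreover have "lq_dist q a c = l * D"
    using lq_norm_scale[OF ab, of l] q l by (simp add: lq_dist_def c_def D_def)
  moreover have "(\<lambda>i. c i - b i) = (\<lambda>i. (1 - l) * (a i - b i))"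
    by (auto simp: c_def algebra_simps)
  then have "lq_dist q c b = (1 - l) * D"
    using lq_norm_scale[OF ab, of "1 - l"] q l by (simp add: lq_dist_def D_def)
  ultimately show ?thesis
    using that[of c] D by (simp add: l_def D_def algebra_simps)
qed


section \<open>Coarse subquotients\<close>

lemma lipschitz_for_large_distances_iff:
  assumes "Metric_space M d" "Metric_space N e" "f \<in> M \<rightarrow> N"
  shows "lipschitz_for_large_distances M d N e f \<longleftrightarrow>
    (\<exists>L>0. \<forall>x\<in>M. \<forall>y\<in>M. e (f x) (f y) \<le> L * max 1 (d x y))" (is "?l \<longleftrightarrow> ?r")
proof
  interpret M: Metric_space M d by fact
  interpret N: Metric_space N e by fact
  {
    assume ?l
    then obtain L where "L > 0" and L: "\<And>r x. 1 \<le> r \<Longrightarrow> x \<in> M \<Longrightarrow>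
        f ` M.mcball x r \<subseteq> N.mcball (f x) (L * r)"
      unfolding lipschitz_for_large_distances_def by (metis zero_less_one)
    have "e (f x) (f y) \<le> L * max 1 (d x y)" if "x \<in> M" "y \<in> M" for x y
    proof -
      have "y \<in> M.mcball x (max 1 (d x y))" using that by simp
      then have "f y \<in> N.mcball (f x) (L * max 1 (d x y))"
        using L[OF max.cobounded1 that(1)] by blast
      then show ?thesis by simp
    qed
    then show ?r using \<open>L > 0\<close> by blast
  }
  assume ?r
  then obtain L where "L > 0" and L: "\<And>x y. x \<in> M \<Longrightarrow> y \<in> M \<Longrightarrow> e (f x) (f y) \<le> L * max 1 (d x y)"
    by blast
  show ?l
    unfolding lipschitz_for_large_distances_def
  proof (intro allI impI)
    fix s :: real
    assume "0 < s"
    define L' where "L' = L * max 1 (1 / s)"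
    have "e (f x) (f y) \<le> L' * r" if "s \<le> r" "x \<in> M" "y \<in> M" "d x y \<le> r" for r x y
    proof -
      have "max 1 (d x y) \<le> max 1 (1 / s) * r"
      proof -
        have "1 \<le> 1 / s * r" using that \<open>0 < s\<close> by (simp add: field_simps)
        also have "\<dots> \<le> max 1 (1 / s) * r" using that \<open>0 < s\<close> by (intro mult_right_mono) auto
        finally have "1 \<le> max 1 (1 / s) * r" .
        moreover have "1 * r \<le> max 1 (1 / s) * r" using that \<open>0 < s\<close> by (intro mult_right_mono) auto
        ultimately show ?thesis using that by simp
      qed
      then have "L * max 1 (d x y) \<le> L * (max 1 (1 / s) * r)"
        using \<open>0 < L\<close> by (intro mult_left_mono) auto
      then show ?thesis using L[OF that(2,3)] by (simp add: L'_def)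
    qed
    moreover have "L' > 0" using \<open>0 < L\<close> by (simp add: L'_def)
    ultimately show "\<exists>L>0. \<forall>r\<ge>s. \<forall>x\<in>M. f ` M.mcball x r \<subseteq> N.mcball (f x) (L * r)"
      using assms(3) by (intro exI[of _ L']) auto
  qed
qed

lemma co_coarsely_continuous_iff:
  assumes "Metric_space M d" "Metric_space N e" "f \<in> M \<rightarrow> N"
  shows "co_coarsely_continuous M d N e f K \<longleftrightarrow>
    (\<forall>\<epsilon>>0. \<exists>\<delta>>0. \<forall>x\<in>M. \<forall>u\<in>N. e (f x) u \<le> \<epsilon> \<longrightarrow> (\<exists>w\<in>M. d x w \<le> \<delta> \<and> e (f w) u \<le> K))"
proof -
  interpret M: Metric_space M d by fact
  interpret N: Metric_space N e by fact
  have "N.mcball (f x) \<epsilon> \<subseteq> thickening N e (f ` M.mcball x \<delta>) K \<longleftrightarrow>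
      (\<forall>u\<in>N. e (f x) u \<le> \<epsilon> \<longrightarrow> (\<exists>w\<in>M. d x w \<le> \<delta> \<and> e (f w) u \<le> K))" if "x \<in> M" for x \<epsilon> \<delta>
  proof -
    have "f x \<in> N" using that assms(3) by blast
    with \<open>x \<in> M\<close> show ?thesis
      by (simp add: thickening_def subset_iff N.commute Bex_def) metis
  qed
  then show ?thesis
    unfolding co_coarsely_continuous_def by (simp only: cong: ball_cong)
qed

text \<open>
  Up to bounded errors, being a coarse subquotient by a map that is Lipschitz for large distances is
  transitive. The set \<open>S\<close> may miss the image of \<open>f\<close>, so the maps cannot simply be composed. However,
  every point of \<open>S\<close> is within the co-coarse constant \<open>K1\<close> of the image of \<open>f\<close>. So take the points \<open>z\<close>
  for which there is a point \<open>s z\<close> of \<open>S\<close> within distance \<open>K1\<close> of \<open>f z\<close>; the map \<open>z \<mapsto> g (s z)\<close> on these \<open>z\<close> does the job, since the Lipschitz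
  condition on \<open>g\<close> controls the effect of a displacement by \<open>2 * K1\<close>.
\<close>

lemma coarse_subquotient_trans:
  fixes d :: "'a \<Rightarrow> 'a \<Rightarrow> real" and d' :: "'b \<Rightarrow> 'b \<Rightarrow> real" and e :: "'c \<Rightarrow> 'c \<Rightarrow> real"
  assumes M: "Metric_space M d" and Y: "Metric_space Y d'" and N: "Metric_space N e"
    and "Z \<subseteq> M" "S \<subseteq> Y"
    and f: "coarse_quotient_map Z d Y d' f" "lipschitz_for_large_distances Z d Y d' f"
    and g: "coarse_quotient_map S d' N e g" "lipschitz_for_large_distances S d' N e g"
  obtains Z' h K L where "Z' \<subseteq> Z" "Z' \<noteq> {}" "h \<in> Z' \<rightarrow> N" "0 \<le> K" "0 < L"
    and "co_coarsely_continuous Z' d N e h K"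
    and "\<And>x y. x \<in> Z' \<Longrightarrow> y \<in> Z' \<Longrightarrow> e (h x) (h y) \<le> L * max 1 (d x y)"
proof -
  interpret M: Metric_space M d by fact
  interpret Y: Metric_space Y d' by fact
  interpret N: Metric_space N e by fact
  have MZ: "Metric_space Z d" using M.subspace \<open>Z \<subseteq> M\<close> .
  have MS: "Metric_space S d'" using Y.subspace \<open>S \<subseteq> Y\<close> .
  have fZ: "f \<in> Z \<rightarrow> Y" and "Z \<noteq> {}" and gS: "g \<in> S \<rightarrow> N" and "S \<noteq> {}"
    using f g by (auto simp: coarse_quotient_map_def)
  obtain K1 where K1: "0 \<le> K1" "co_coarsely_continuous Z d Y d' f K1"
    using f by (auto simp: coarse_quotient_map_def)
  obtain K2 where K2: "0 \<le> K2" "co_coarsely_continuous S d' N e g K2"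
    using g by (auto simp: coarse_quotient_map_def)
  obtain L1 where L1: "0 < L1"
      "\<And>x y. x \<in> Z \<Longrightarrow> y \<in> Z \<Longrightarrow> d' (f x) (f y) \<le> L1 * max 1 (d x y)"
    using f(2) lipschitz_for_large_distances_iff[OF MZ Y fZ] by blast
  obtain L2 where L2: "0 < L2"
      "\<And>x y. x \<in> S \<Longrightarrow> y \<in> S \<Longrightarrow> e (g x) (g y) \<le> L2 * max 1 (d' x y)"
    using g(2) lipschitz_for_large_distances_iff[OF MS N gS] by blast
  have co_f: "\<exists>\<delta>>0. \<forall>x\<in>Z. \<forall>u\<in>Y. d' (f x) u \<le> \<epsilon> \<longrightarrow> (\<exists>w\<in>Z. d x w \<le> \<delta> \<and> d' (f w) u \<le> K1)"
    if "\<epsilon> > 0" for \<epsilon>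
    using K1(2) that co_coarsely_continuous_iff[OF MZ Y fZ] by simp
  have co_g: "\<exists>\<delta>>0. \<forall>x\<in>S. \<forall>u\<in>N. e (g x) u \<le> \<epsilon> \<longrightarrow> (\<exists>w\<in>S. d' x w \<le> \<delta> \<and> e (g w) u \<le> K2)"
    if "\<epsilon> > 0" for \<epsilon>
    using K2(2) that co_coarsely_continuous_iff[OF MS N gS] by simp
  define Z' where "Z' = {z \<in> Z. \<exists>y\<in>S. d' (f z) y \<le> K1}"
  define s where "s = (\<lambda>z. SOME y. y \<in> S \<and> d' (f z) y \<le> K1)"
  have s: "s z \<in> S" "d' (f z) (s z) \<le> K1" if "z \<in> Z'" for z
    using that unfolding s_def Z'_def
    by (metis (mono_tags, lifting) mem_Collect_eq someI_ex)+
  have "Z' \<noteq> {}"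
  proof -
    obtain y z where yz: "y \<in> S" "z \<in> Z" using \<open>S \<noteq> {}\<close> \<open>Z \<noteq> {}\<close> by blast
    have "d' (f z) y + 1 > 0" by (simp add: add_nonneg_pos)
    from co_f[OF this] obtain \<delta> where
      "\<forall>x\<in>Z. \<forall>u\<in>Y. d' (f x) u \<le> d' (f z) y + 1 \<longrightarrow> (\<exists>w\<in>Z. d x w \<le> \<delta> \<and> d' (f w) u \<le> K1)"
      by blast
    moreover have "y \<in> Y" "d' (f z) y \<le> d' (f z) y + 1" using yz \<open>S \<subseteq> Y\<close> by auto
    ultimately obtain w where "w \<in> Z" "d' (f w) y \<le> K1"
      using yz(2) by blast
    then show ?thesis using yz by (auto simp: Z'_def)
  qed
  define h where "h = (\<lambda>z. g (s z))"
  have hN: "h \<in> Z' \<rightarrow> N" using s gS by (auto simp: h_def)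
  have "Z' \<subseteq> Z" by (auto simp: Z'_def)
  have MZ': "Metric_space Z' d" using Metric_space.subspace[OF MZ \<open>Z' \<subseteq> Z\<close>] .
  have YS: "y \<in> Y" if "y \<in> S" for y using that \<open>S \<subseteq> Y\<close> by blast
  have fY: "f z \<in> Y" "s z \<in> Y" if "z \<in> Z'" for z
    using that fZ s YS \<open>Z' \<subseteq> Z\<close> by auto
  define K where "K = L2 * max 1 (2 * K1) + K2"
  have co: "co_coarsely_continuous Z' d N e h K"
    unfolding co_coarsely_continuous_iff[OF MZ' N hN]
  proof (intro allI impI)
    fix \<epsilon> :: real
    assume "0 < \<epsilon>"
    then obtain \<delta> where \<delta>: "\<delta> > 0"
      "\<And>x u. x \<in> S \<Longrightarrow> u \<in> N \<Longrightarrow> e (g x) u \<le> \<epsilon> \<Longrightarrow> \<exists>w\<in>S. d' x w \<le> \<delta> \<and> e (g w) u \<le> K2"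
      using co_g[of \<epsilon>] by blast
    have "K1 + \<delta> > 0" using \<delta>(1) K1(1) by simp
    then obtain \<eta> where \<eta>: "\<eta> > 0"
      "\<And>x u. x \<in> Z \<Longrightarrow> u \<in> Y \<Longrightarrow> d' (f x) u \<le> K1 + \<delta> \<Longrightarrow> \<exists>w\<in>Z. d x w \<le> \<eta> \<and> d' (f w) u \<le> K1"
      using co_f[of "K1 + \<delta>"] by blast
    have "\<exists>w\<in>Z'. d x w \<le> \<eta> \<and> e (h w) u \<le> K" if x: "x \<in> Z'" and u: "u \<in> N" "e (h x) u \<le> \<epsilon>" for x u
    proof -
      obtain y where y: "y \<in> S" "d' (s x) y \<le> \<delta>" "e (g y) u \<le> K2"
        using \<delta>(2)[OF s(1)[OF x] u(1)] u(2) by (auto simp: h_def)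
      have "d' (f x) y \<le> K1 + \<delta>"
        using Y.triangle[of "f x" "s x" y] s(2)[OF x] y fY[OF x] YS by auto
      then obtain w where w: "w \<in> Z" "d x w \<le> \<eta>" "d' (f w) y \<le> K1"
        using \<eta>(2)[of x y] x \<open>Z' \<subseteq> Z\<close> YS y by auto
      then have w': "w \<in> Z'" using y by (auto simp: Z'_def)
      have "d' (s w) y \<le> 2 * K1"
        using Y.triangle[of "s w" "f w" y] s(2)[OF w'] w(3) fY[OF w'] YS[OF y(1)]
        by (simp add: Y.commute)
      then have "L2 * max 1 (d' (s w) y) \<le> L2 * max 1 (2 * K1)"
        using L2(1) by (intro mult_left_mono) auto
      then have "e (h w) (g y) \<le> L2 * max 1 (2 * K1)"
        using L2(2)[OF s(1)[OF w'] y(1)] by (simp add: h_def)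
      moreover have "e (h w) u \<le> e (h w) (g y) + e (g y) u"
        using hN w' gS y u by (intro N.triangle) auto
      ultimately have "e (h w) u \<le> K" using y by (simp add: K_def)
      then show ?thesis using w w' by blast
    qed
    then show "\<exists>\<delta>>0. \<forall>x\<in>Z'. \<forall>u\<in>N. e (h x) u \<le> \<epsilon> \<longrightarrow> (\<exists>w\<in>Z'. d x w \<le> \<delta> \<and> e (h w) u \<le> K)"
      using \<eta>(1) by blast
  qed
  define L where "L = L2 * (1 + 2 * K1 + L1)"
  have lip: "e (h x) (h y) \<le> L * max 1 (d x y)" if x: "x \<in> Z'" and y: "y \<in> Z'" for x y
  proof -
    have "d' (s x) (s y) \<le> d' (s x) (f x) + d' (f x) (f y) + d' (f y) (s y)"
      using Y.triangle[of "s x" "f x" "s y"] Y.triangle[of "f x" "f y" "s y"] fY[OF x] fY[OF y] by simp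
    also have "\<dots> \<le> K1 + L1 * max 1 (d x y) + K1"
      using s(2)[OF x] s(2)[OF y] L1(2)[of x y] x y \<open>Z' \<subseteq> Z\<close> by (force simp: Y.commute)
    finally have "max 1 (d' (s x) (s y)) \<le> 1 + 2 * K1 + L1 * max 1 (d x y)"
      using K1 L1 by (auto simp: max_def)
    also have "\<dots> \<le> (1 + 2 * K1) * max 1 (d x y) + L1 * max 1 (d x y)"
      using K1(1) mult_left_mono[of 1 "max 1 (d x y)" "1 + 2 * K1"] by simp
    finally have "L2 * max 1 (d' (s x) (s y)) \<le> L2 * ((1 + 2 * K1 + L1) * max 1 (d x y))"
      using L2(1) by (intro mult_left_mono) (auto simp: algebra_simps)
    then show ?thesis
      using L2(2)[OF s(1)[OF x] s(1)[OF y]] by (simp add: h_def L_def)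
  qed
  show ?thesis
  proof (rule that[of Z' h K L])
    show "0 \<le> K" using K1 K2 L2(1) by (simp add: K_def)
    show "0 < L" using K1 L1 L2 by (simp add: L_def)
  qed (use \<open>Z' \<subseteq> Z\<close> \<open>Z' \<noteq> {}\<close> hN co lip in auto)
qed

text \<open>
  Walk along segments towards \<open>u\<close> in steps of length \<open>2 * K + 1\<close>, lifting each step at cost \<open>\<delta>\<close>. A lifted
  step misses its target by at most \<open>K\<close>, so the distance to \<open>u\<close> still drops by at least \<open>K + 1\<close>. As each
  step aims anew at \<open>u\<close>, the errors do not add up, and the final error is \<open>K\<close> whatever the distance.
\<close>

lemma co_lipschitz_for_large_distances:
  fixes Z :: "'x::metric_space set"
  assumes q: "1 \<le> q" and h: "h \<in> Z \<rightarrow> lq_space q" and K: "0 \<le> K"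
    and co: "co_coarsely_continuous Z dist (lq_space q) (lq_dist q) h K"
  obtains C where "0 < C"
    and "\<And>r x u. 1 \<le> r \<Longrightarrow> x \<in> Z \<Longrightarrow> u \<in> lq_space q \<Longrightarrow> lq_dist q (h x) u \<le> r \<Longrightarrow>
      \<exists>w\<in>Z. dist x w \<le> C * r \<and> lq_dist q (h w) u \<le> K"
proof -
  interpret lq: Metric_space "lq_space q" "lq_dist q"
    by (rule Metric_space_lq[OF q])
  have MZ: "Metric_space Z dist"
    using Met_TC.subspace[of Z] by simp
  have "2 * K + 1 > 0" using K by simp
  then obtain \<delta> where "0 < \<delta>" and \<delta>: "\<And>x u. x \<in> Z \<Longrightarrow> u \<in> lq_space q \<Longrightarrow>
      lq_dist q (h x) u \<le> 2 * K + 1 \<Longrightarrow> \<exists>w\<in>Z. dist x w \<le> \<delta> \<and> lq_dist q (h w) u \<le> K"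
    using co unfolding co_coarsely_continuous_iff[OF MZ lq.Metric_space_axioms h] by blast
  have chain: "\<exists>w\<in>Z. dist x w \<le> real m * \<delta> \<and> lq_dist q (h w) u \<le> K"
    if "x \<in> Z" "u \<in> lq_space q" "lq_dist q (h x) u \<le> K + real m * (K + 1)" for m x u
    using that
  proof (induction m arbitrary: x)
    case 0
    then show ?case by auto
  next
    case (Suc m)
    have hx: "h x \<in> lq_space q" using h Suc.prems by blast
    define s where "s = min (2 * K + 1) (lq_dist q (h x) u)"
    have "0 \<le> s" "s \<le> lq_dist q (h x) u" using K by (simp_all add: s_def)
    then obtain c where c: "c \<in> lq_space q" "lq_dist q (h x) c = s"
        "lq_dist q c u = lq_dist q (h x) u - s"
      using lq_segment[OF q hx Suc.prems(2)] by blast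
    then obtain w where w: "w \<in> Z" "dist x w \<le> \<delta>" "lq_dist q (h w) c \<le> K"
      using \<delta>[of x c] Suc.prems(1) by (auto simp: s_def)
    have "lq_dist q (h w) u \<le> lq_dist q (h w) c + lq_dist q c u"
      using h w c Suc.prems by (intro lq.triangle) auto
    also have "\<dots> \<le> K + (lq_dist q (h x) u - s)"
      using c w by simp
    also have "\<dots> \<le> K + real m * (K + 1)"
      using Suc.prems(3) K by (auto simp: s_def min_def algebra_simps)
    finally obtain w' where w': "w' \<in> Z" "dist w w' \<le> real m * \<delta>" "lq_dist q (h w') u \<le> K"
      using Suc.IH[OF w(1) Suc.prems(2)] by blast
    have "dist x w' \<le> real (Suc m) * \<delta>"
      using dist_triangle[of x w' w] w w' by (simp add: algebra_simps)
    then show ?case using w' by blast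
  qed
  have "\<exists>w\<in>Z. dist x w \<le> 2 * \<delta> * r \<and> lq_dist q (h w) u \<le> K"
    if r: "1 \<le> r" and xu: "x \<in> Z" "u \<in> lq_space q" "lq_dist q (h x) u \<le> r" for r x u
  proof -
    define m where "m = nat \<lceil>r\<rceil>"
    have m: "r \<le> real m" "real m \<le> 2 * r"
      using r unfolding m_def by linarith+
    have "real m * 1 \<le> real m * (K + 1)" using K by (intro mult_left_mono) auto
    then have "lq_dist q (h x) u \<le> K + real m * (K + 1)"
      using xu(3) m(1) K by linarith
    from chain[OF xu(1,2) this] obtain w where w: "w \<in> Z" "dist x w \<le> real m * \<delta>" "lq_dist q (h w) u \<le> K"
      by blast
    have "real m * \<delta> \<le> 2 * r * \<delta>" using m(2) \<open>0 < \<delta>\<close> by (intro mult_right_mono) auto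
    then show ?thesis using w by (intro bexI[of _ w]) (auto simp: mult_ac)
  qed
  then show ?thesis using that[of "2 * \<delta>"] \<open>0 < \<delta>\<close> by simp
qed


section \<open>Forks and property \<open>(\<beta>\<^sub>p)\<close>\<close>

text \<open>
  The form in which \<open>(\<beta>\<^sub>p)\<close> is used. In the fork with root \<open>x\<close>, centre \<open>0\<close> and tips \<open>y i\<close>, every arm has
  length at most \<open>R\<close>, so every tip is within \<open>2 * R\<close> of the root. If the tips are \<open>\<tau> * R\<close>-separated,
  then one of them is closer by a definite factor. Half of the constant in \<open>(\<beta>\<^sub>p)\<close> is given away because
  the infimum in the modulus need not be attained.
\<close>

lemma property_beta_fork:
  assumes \<nu>: "equivalent_norm \<nu>" and beta: "property_beta \<nu> p"
  obtains \<gamma> where "0 < \<gamma>"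
    and "\<And>R \<tau> x y. 0 < R \<Longrightarrow> 0 < \<tau> \<Longrightarrow> \<nu> x \<le> R \<Longrightarrow> (\<And>i :: nat. \<nu> (y i) \<le> R) \<Longrightarrow>
      (\<And>i j. i < j \<Longrightarrow> \<tau> * R \<le> \<nu> (y i - y j)) \<Longrightarrow>
      \<exists>i. \<nu> (x - y i) \<le> 2 * R * (1 - \<gamma> * \<tau> powr p)"
proof -
  obtain \<gamma> where "0 < \<gamma>"
    and \<gamma>: "\<And>t. t \<in> beta_modulus_domain \<nu> \<Longrightarrow> \<gamma> * t powr p \<le> beta_modulus \<nu> t"
    using beta unfolding property_beta_def by blast
  have scale: "\<nu> (c *\<^sub>R x) = \<bar>c\<bar> * \<nu> x" for c x
    using \<nu> by (simp add: equivalent_norm_def)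
  have tri: "\<nu> (x + y) \<le> \<nu> x + \<nu> y" for x y
    using \<nu> by (simp add: equivalent_norm_def)
  have minus: "\<nu> (x - y) = \<nu> (y - x)" for x y
    using scale[of "-1" "x - y"] by simp
  have nonneg: "0 \<le> \<nu> x" for x
    using tri[of x "- x"] scale[of 0 0] scale[of "-1" x] by simp
  have sub: "\<nu> (x - y) \<le> \<nu> x + \<nu> y" for x y
    using tri[of x "- y"] scale[of "-1" y] by simp
  have "\<exists>i. \<nu> (x - y i) \<le> 2 * R * (1 - \<gamma> / 2 * \<tau> powr p)"
    if R: "0 < R" and \<tau>: "0 < \<tau>" and x: "\<nu> x \<le> R" and y: "\<And>i :: nat. \<nu> (y i) \<le> R"
      and sep_y: "\<And>i j. i < j \<Longrightarrow> \<tau> * R \<le> \<nu> (y i - y j)" for R \<tau> x y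
  proof -
    define x' where "x' = (1 / R) *\<^sub>R x"
    define y' where "y' = (\<lambda>i. (1 / R) *\<^sub>R y i)"
    have x': "\<nu> x' \<le> 1" and y': "\<And>i. \<nu> (y' i) \<le> 1"
      using x y R by (simp_all add: x'_def y'_def scale)
    have x_diff: "\<nu> (x' - y' i) = \<nu> (x - y i) / R" for i
      using scale[of "1 / R" "x - y i"] R by (simp add: x'_def y'_def scaleR_diff_right)
    have y_diff: "\<nu> (y' i - y' j) = \<nu> (y i - y j) / R" for i j
      using scale[of "1 / R" "y i - y j"] R by (simp add: y'_def scaleR_diff_right)
    have "\<tau> \<le> \<nu> (y' i - y' j)" if "i \<noteq> j" for i j
    proof -
      have "\<tau> * R \<le> \<nu> (y i - y j)"
        using sep_y[of i j] sep_y[of j i] minus[of "y i" "y j"] that by (cases "i < j") auto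
      then show ?thesis
        using R by (simp add: y_diff pos_le_divide_eq)
    qed
    then have "\<tau> \<le> (case z of (i, j) \<Rightarrow> \<nu> (y' i - y' j))" if "z \<in> {(i, j). i \<noteq> j}" for z
      using that by (cases z) simp
    moreover have "(0, 1) \<in> {(n :: nat, m :: nat). n \<noteq> m}"
      by simp
    then have "{(n :: nat, m :: nat). n \<noteq> m} \<noteq> {}"
      by (metis empty_iff)
    ultimately have "\<tau> \<le> sep \<nu> y'"
      unfolding sep_def by (rule cINF_greatest[rotated])
    then have y'_in: "y' \<in> separated_ball_seqs \<nu> \<tau>"
      using y' by (simp add: separated_ball_seqs_def)
    then have "\<tau> \<in> beta_modulus_domain \<nu>"
      using \<tau> by (auto simp: beta_modulus_domain_def)
    note gap = \<gamma>[OF this]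
    define F where "F = (\<lambda>(x, y :: nat \<Rightarrow> 'a). INF i. \<nu> (x - y i) / 2)"
    have bdd: "bdd_below (range (\<lambda>i :: nat. \<nu> (x - y i) / 2))" for x y
      by (rule bdd_belowI[of _ 0]) (auto simp: nonneg)
    have "F (x', y') \<le> (SUP z \<in> {x. \<nu> x \<le> 1} \<times> separated_ball_seqs \<nu> \<tau>. F z)"
    proof (rule cSUP_upper)
      show "(x', y') \<in> {x. \<nu> x \<le> 1} \<times> separated_ball_seqs \<nu> \<tau>"
        using x' y'_in by simp
      show "bdd_above (F ` ({x. \<nu> x \<le> 1} \<times> separated_ball_seqs \<nu> \<tau>))"
      proof (rule bdd_aboveI2)
        fix z
        assume z: "z \<in> {x. \<nu> x \<le> 1} \<times> separated_ball_seqs \<nu> \<tau>"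
        obtain u v where uv: "z = (u, v)" by (cases z)
        have "F z \<le> \<nu> (u - v 0) / 2"
          unfolding uv F_def prod.case by (rule cINF_lower[OF bdd]) simp
        also have "\<dots> \<le> 1"
        proof -
          have "\<nu> u \<le> 1" "\<nu> (v 0) \<le> 1"
            using z by (simp_all add: uv separated_ball_seqs_def)
          then show ?thesis using sub[of u "v 0"] by simp
        qed
        finally show "F z \<le> 1" .
      qed
    qed
    also have "\<dots> = 1 - beta_modulus \<nu> \<tau>"
      by (simp add: beta_modulus_def F_def)
    also have "\<dots> < 1 - \<gamma> / 2 * \<tau> powr p"
      using gap \<open>0 < \<gamma>\<close> \<tau> by (smt (verit) field_sum_of_halves mult_pos_pos powr_gt_zero distrib_right)
    finally have "(INF i. \<nu> (x' - y' i) / 2) < 1 - \<gamma> / 2 * \<tau> powr p"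
      by (simp add: F_def)
    then obtain i where "\<nu> (x' - y' i) / 2 < 1 - \<gamma> / 2 * \<tau> powr p"
      using cINF_less_iff[OF UNIV_not_empty bdd] by auto
    then have "\<nu> (x - y i) \<le> 2 * R * (1 - \<gamma> / 2 * \<tau> powr p)"
      using R by (simp add: x_diff field_simps)
    then show ?thesis ..
  qed
  then show ?thesis
    using that[of "\<gamma> / 2"] \<open>0 < \<gamma>\<close> by simp
qed


section \<open>Lifting displacements with detours\<close>

text \<open>
  A displacement \<open>v\<close> of length at most \<open>r\<close> in \<open>\<ell>\<^sub>q\<close>, begun at \<open>h x\<close>, can be lifted at cost \<open>D\<close> up to a
  coordinatewise error \<open>\<kappa>\<close>. The end point is only required to be right in the first \<open>N\<close> coordinates.
  This tolerance leaves room for the lifts to make detours in far coordinates, whereas a single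
  coordinate already shows how far the lifted point has moved. Since \<open>N\<close> is arbitrary, later
  detours can be kept away from earlier ones.
\<close>

definition tracks ::
  "('x::real_vector \<Rightarrow> real) \<Rightarrow> 'x set \<Rightarrow> real \<Rightarrow> ('x \<Rightarrow> nat \<Rightarrow> real) \<Rightarrow> real \<Rightarrow> real \<Rightarrow> real \<Rightarrow> bool"
where
  "tracks \<nu> Z q h r D \<kappa> \<longleftrightarrow>
     (\<forall>x\<in>Z. \<forall>v N. finite {i. v i \<noteq> 0} \<longrightarrow> lq_norm q v \<le> r \<longrightarrow>
        (\<exists>w\<in>Z. \<nu> (x - w) \<le> D \<and> (\<forall>j<N. \<bar>h w j - h x j - v j\<bar> \<le> \<kappa>)))"

lemma tracksE:
  assumes "tracks \<nu> Z q h r D \<kappa>" "x \<in> Z" "finite {i. v i \<noteq> 0}" "lq_norm q v \<le> r"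
  obtains w where "w \<in> Z" "\<nu> (x - w) \<le> D" "\<And>j. j < N \<Longrightarrow> \<bar>h w j - h x j - v j\<bar> \<le> \<kappa>"
  using assms unfolding tracks_def by meson

lemma tracks_mono:
  assumes "tracks \<nu> Z q h r D \<kappa>" "D \<le> D'"
  shows "tracks \<nu> Z q h r D' \<kappa>"
  using assms unfolding tracks_def by (meson order_trans)

text \<open>
  To lift a displacement \<open>v\<close>, first lift \<open>v / 2\<close> and reach a centre \<open>z\<close>. From \<open>z\<close>, lift infinitely many
  different displacements, each being \<open>v / 2\<close> plus a detour \<open>s\<close> in one new coordinate. The detours
  make the images \<open>s - 2 * \<kappa>\<close>-separated, so the Lipschitz condition separates the lifts \<open>w i\<close> as well,
  and the fork with root \<open>x\<close>, centre \<open>z\<close> and tips \<open>w i\<close> contains a tip that is nearer to \<open>x\<close> than the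
  two lifts would suggest. It still ends at the correct place because the detour took place in
  a coordinate beyond \<open>N\<close>.
\<close>

lemma tracks_double:
  fixes Z :: "'x::real_normed_vector set" and \<nu> :: "'x \<Rightarrow> real"
  assumes q: "1 \<le> q" and h: "h \<in> Z \<rightarrow> lq_space q" and \<nu>: "equivalent_norm \<nu>"
    and a: "0 < a" "\<And>x. a * norm x \<le> \<nu> x"
    and L: "0 < L" "\<And>x y. x \<in> Z \<Longrightarrow> y \<in> Z \<Longrightarrow> lq_dist q (h x) (h y) \<le> L * max 1 (dist x y)"
    and fork: "\<And>R \<tau> x y. 0 < R \<Longrightarrow> 0 < \<tau> \<Longrightarrow> \<nu> x \<le> R \<Longrightarrow> (\<And>i :: nat. \<nu> (y i) \<le> R) \<Longrightarrow>
      (\<And>i j. i < j \<Longrightarrow> \<tau> * R \<le> \<nu> (y i - y j)) \<Longrightarrow>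
      \<exists>i. \<nu> (x - y i) \<le> 2 * R * (1 - \<gamma> * \<tau> powr p)"
    and T: "tracks \<nu> Z q h r D \<kappa>" and pos: "0 < D" "0 < \<kappa>" "0 \<le> r" "0 \<le> \<rho>"
    and s: "L < s - 2 * \<kappa>" "\<rho> powr q + s powr q \<le> r powr q"
    and \<tau>: "0 < \<tau>" "\<tau> * D \<le> a * (s - 2 * \<kappa>) / L"
  shows "tracks \<nu> Z q h (2 * \<rho>) (2 * D * (1 - \<gamma> * \<tau> powr p)) (2 * \<kappa>)"
  unfolding tracks_def
proof (intro ballI allI impI)
  fix x v N
  assume x: "x \<in> Z" and fin: "finite {i. v i \<noteq> (0::real)}" and v: "lq_norm q v \<le> 2 * \<rho>"
  have minus: "\<nu> (x - y) = \<nu> (y - x)" for x y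
    using \<nu> unfolding equivalent_norm_def
    by (metis abs_minus_cancel abs_one minus_diff_eq mult_1 scaleR_minus1_left)
  have s0: "0 < s" using s L(1) pos by linarith
  define v2 where "v2 = (\<lambda>i. 1 / 2 * v i)"
  have fin2: "finite {i. v2 i \<noteq> 0}" using fin by (simp add: v2_def)
  have v_lq: "v \<in> lq_space q" and v2_lq: "v2 \<in> lq_space q"
    using fin fin2 by (auto intro: finite_support_in_lq_space)
  have v2: "lq_norm q v2 \<le> \<rho>"
    using lq_norm_scale[OF v_lq, of "1 / 2"] q v by (simp add: v2_def)
  then have v2q: "lq_norm q v2 powr q \<le> \<rho> powr q"
    using q by (intro powr_mono2) auto
  have "\<rho> powr q \<le> r powr q"
    using s(2) powr_ge_zero[of s q] by linarith
  then have "\<rho> \<le> r"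
    using q pos powr_less_mono2[of q r \<rho>] by fastforce
  then obtain z where z: "z \<in> Z" "\<nu> (x - z) \<le> D" "\<And>j. j < N \<Longrightarrow> \<bar>h z j - h x j - v2 j\<bar> \<le> \<kappa>"
    using tracksE[OF T x fin2, of N] v2 by auto
  \<comment> \<open>A lift \<open>w\<close> with its detour in coordinate \<open>n\<close>. From coordinate \<open>b\<close> on, \<open>h w\<close> is indistinguishable
      from \<open>h z\<close>, since both lie in \<open>\<ell>\<^sub>q\<close>; the next detour must therefore be taken at or beyond \<open>b\<close>.\<close>
  define good where "good = (\<lambda>w n b. w \<in> Z \<and> \<nu> (z - w) \<le> D \<and>
      (\<forall>j<N. \<bar>h w j - h z j - v2 j\<bar> \<le> \<kappa>) \<and> s - \<kappa> \<le> h w n - h z n \<and>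
      (\<forall>m\<ge>b. \<bar>h w m - h z m\<bar> \<le> \<kappa>))"
  have ex: "\<exists>w n b. good w n b \<and> B \<le> n \<and> B \<le> b" for B :: nat
  proof -
    obtain M where M: "\<And>i. M \<le> i \<Longrightarrow> v2 i = 0"
      using fin2 by (metis (mono_tags, lifting) finite_nat_set_iff_bounded mem_Collect_eq not_le)
    define n where "n = max M (max N B)"
    define v' where "v' = v2(n := s)"
    have vn: "v2 n = 0" by (simp add: M n_def)
    have "finite {i. v' i \<noteq> 0}"
      by (rule finite_subset[of _ "insert n {i. v2 i \<noteq> 0}"]) (auto simp: v'_def fin2)
    moreover have "lq_norm q v' \<le> r"
    proof -
      have "lq_norm q v' powr q = lq_norm q v2 powr q + \<bar>s\<bar> powr q"
        using lq_norm_powr_fun_upd[OF _ v2_lq vn] q by (simp add: v'_def)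
      then have "lq_norm q v' powr q \<le> r powr q"
        using v2q s(2) s0 by simp
      then show ?thesis
        using q pos powr_less_mono2[of q r "lq_norm q v'"] by fastforce
    qed
    ultimately obtain w where w: "w \<in> Z" "\<nu> (z - w) \<le> D"
        "\<And>j. j < Suc n \<Longrightarrow> \<bar>h w j - h z j - v' j\<bar> \<le> \<kappa>"
      using tracksE[OF T z(1), of v' "Suc n"] by blast
    have "(\<lambda>i. h w i - h z i) \<longlonglongrightarrow> 0"
      using q h w z by (intro lq_coord_tendsto_0[of _ q] lq_space_diff) auto
    then obtain b where b: "\<And>m. b \<le> m \<Longrightarrow> \<bar>h w m - h z m\<bar> < \<kappa>"
      using LIMSEQ_D[OF _ pos(2)] by fastforce
    have "good w n (max b B)"
      unfolding good_def
    proof (intro conjI allI impI)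
      show "\<bar>h w j - h z j - v2 j\<bar> \<le> \<kappa>" if "j < N" for j
      proof -
        have "j < Suc n" "j \<noteq> n" using that by (auto simp: n_def)
        then show ?thesis using w(3)[of j] by (simp add: v'_def)
      qed
      show "s - \<kappa> \<le> h w n - h z n"
        using w(3)[of n] by (simp add: v'_def)
    qed (use w b less_imp_le in auto)
    moreover have "B \<le> n" "B \<le> max b B" by (simp_all add: n_def)
    ultimately show ?thesis by blast
  qed
  have "\<exists>S. \<forall>i. good (fst (S i)) (fst (snd (S i))) (snd (snd (S i))) \<and>
      snd (snd (S i)) \<le> fst (snd (S (Suc i))) \<and> snd (snd (S i)) \<le> snd (snd (S (Suc i)))"
    by (rule dependent_nat_choice[where P = "\<lambda>_ S. good (fst S) (fst (snd S)) (snd (snd S))"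
          and Q = "\<lambda>_ S S'. snd (snd S) \<le> fst (snd S') \<and> snd (snd S) \<le> snd (snd S')"])
      (simp, use ex in blast, simp add: ex)
  then obtain S where S: "\<And>i. good (fst (S i)) (fst (snd (S i))) (snd (snd (S i)))"
    "\<And>i. snd (snd (S i)) \<le> fst (snd (S (Suc i)))"
    "\<And>i. snd (snd (S i)) \<le> snd (snd (S (Suc i)))"
    by blast
  define w where "w = (\<lambda>i. fst (S i))"
  define n where "n = (\<lambda>i. fst (snd (S i)))"
  define b where "b = (\<lambda>i. snd (snd (S i)))"
  have good: "good (w i) (n i) (b i)" for i
    using S(1)[of i] by (simp add: w_def n_def b_def)
  have b_n: "b i \<le> n (Suc i)" and b_b: "b i \<le> b (Suc i)" for i
    using S(2,3)[of i] by (simp_all add: n_def b_def)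
  have wZ: "w i \<in> Z" and wD: "\<nu> (w i - z) \<le> D" for i
    using good[of i] by (auto simp: good_def minus)
  have sep_w: "\<tau> * D \<le> \<nu> ((w i - z) - (w j - z))" if "i < j" for i j
  proof -
    obtain k where k: "j = Suc k" "i \<le> k" using \<open>i < j\<close> by (cases j) auto
    have "b i \<le> n j"
      using lift_Suc_mono_le[of b, OF b_b k(2)] b_n[of k] k(1) by simp
    then have "h (w i) (n j) - h z (n j) \<le> \<kappa>"
      using good[of i] by (auto simp: good_def abs_le_iff)
    moreover have "s - \<kappa> \<le> h (w j) (n j) - h z (n j)"
      using good[of j] by (auto simp: good_def)
    ultimately have "s - 2 * \<kappa> \<le> \<bar>h (w i) (n j) - h (w j) (n j)\<bar>"
      by linarith
    also have "\<dots> \<le> lq_dist q (h (w i)) (h (w j))"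
      unfolding lq_dist_def using h wZ q
      by (intro abs_coord_le_lq_norm[of "\<lambda>m. h (w i) m - h (w j) m"] lq_space_diff) auto
    also have "\<dots> \<le> L * max 1 (dist (w i) (w j))"
      by (rule L(2)[OF wZ wZ])
    \<comment> \<open>The bound exceeds \<open>L\<close>, so the points are too far apart for the constant \<open>1\<close> to be the maximum.\<close>
    finally have le: "s - 2 * \<kappa> \<le> L * max 1 (dist (w i) (w j))" .
    with s(1) have "s - 2 * \<kappa> \<le> L * dist (w i) (w j)"
      by (auto simp: max_def split: if_splits)
    then have "(s - 2 * \<kappa>) / L \<le> norm (w i - w j)"
      using L(1) by (simp add: pos_divide_le_eq mult.commute dist_norm)
    then have "a * ((s - 2 * \<kappa>) / L) \<le> a * norm (w i - w j)"
      using a(1) by (intro mult_left_mono) auto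
    then show ?thesis using \<tau>(2) a(2)[of "w i - w j"] by simp
  qed
  obtain i where i: "\<nu> ((x - z) - (w i - z)) \<le> 2 * D * (1 - \<gamma> * \<tau> powr p)"
    using fork[OF pos(1) \<tau>(1) z(2) wD sep_w] by blast
  have "\<bar>h (w i) j - h x j - v j\<bar> \<le> 2 * \<kappa>" if "j < N" for j
  proof -
    have "\<bar>h (w i) j - h z j - v2 j\<bar> \<le> \<kappa>"
      using good[of i] that by (auto simp: good_def)
    moreover have "\<bar>h z j - h x j - v2 j\<bar> \<le> \<kappa>" by (rule z(3)[OF that])
    moreover have "v j = v2 j + v2 j" by (simp add: v2_def)
    ultimately show ?thesis by linarith
  qed
  then show "\<exists>w\<in>Z. \<nu> (x - w) \<le> 2 * D * (1 - \<gamma> * \<tau> powr p) \<and> (\<forall>j<N. \<bar>h w j - h x j - v j\<bar> \<le> 2 * \<kappa>)"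
    using wZ i by (intro bexI[of _ "w i"]) auto
qed

text \<open>
  The factor \<open>(1 + t\<^sup>q)\<^bsup>1/q\<^esup>\<close> is the extra length caused by detours of relative size \<open>t\<close>, and \<open>1 - A * t\<^sup>p\<close>
  is the saving that \<open>(\<beta>\<^sub>p)\<close> gives in return. As \<open>p < q\<close>, the saving wins for small \<open>t\<close>; the choice of \<open>t\<close>
  makes \<open>t\<^sup>q \<le> A * t\<^sup>p\<close>.
\<close>

lemma gain_beats_loss:
  fixes A p q :: real
  assumes "0 < A" "p < q" "1 \<le> q"
  obtains t \<theta> where "0 < t" "t \<le> 1" "0 < \<theta>" "\<theta> < 1" "(1 + t powr q) powr (1 / q) * (1 - A * t powr p) \<le> \<theta>"
proof -
  define t where "t = min 1 (A powr (1 / (q - p)))"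
  have t: "0 < t" "t \<le> 1" using assms by (auto simp: t_def)
  have "t powr (q - p) \<le> (A powr (1 / (q - p))) powr (q - p)"
    using assms t by (intro powr_mono2) (auto simp: t_def)
  also have "\<dots> = A" using assms by (simp add: powr_powr)
  finally have "t powr (q - p) * t powr p \<le> A * t powr p"
    by (intro mult_right_mono) auto
  then have B: "t powr q \<le> A * t powr p"
    by (simp add: powr_add[symmetric])
  have B0: "0 < t powr q" using t by simp
  have "(1 + t powr q) powr (1 / q) \<le> (1 + t powr q) powr 1"
    using assms by (intro powr_mono) auto
  then have root: "(1 + t powr q) powr (1 / q) \<le> 1 + t powr q" by simp
  have "(1 + t powr q) powr (1 / q) * (1 - A * t powr p) \<le> (1 + t powr q) powr (1 / q) * (1 - t powr q)"
    using B by (intro mult_left_mono) auto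
  also have "\<dots> \<le> (1 + t powr q) * (1 - t powr q)"
    using root t assms by (intro mult_right_mono) (auto simp: powr_le1)
  also have "\<dots> = 1 - (t powr q)\<^sup>2" by (simp add: power2_eq_square algebra_simps)
  finally have "(1 + t powr q) powr (1 / q) * (1 - A * t powr p) \<le> max (1/2) (1 - (t powr q)\<^sup>2)"
    by simp
  then show ?thesis
    using that[of t "max (1/2) (1 - (t powr q)\<^sup>2)"] t B0 by simp
qed

text \<open>
  The cost per unit length of lifting displacements starts at a constant \<open>C\<close> and is multiplied by
  \<open>\<theta> < 1\<close> at each doubling, until it is smaller than the Lipschitz constant of \<open>h\<close> permits. The detour
  size \<open>t\<close> and the number \<open>n\<close> of doublings depend only on \<open>C\<close>, \<open>L\<close> and the norm. The starting length \<open>r0\<close>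
  is chosen last, so large that even the final error \<open>2 ^ n * \<kappa>\<close> is negligible against the shortest
  detour.
\<close>

lemma lq_not_coarse_subquotient_of_beta:
  fixes Z :: "'x::real_normed_vector set" and \<nu> :: "'x \<Rightarrow> real"
  assumes pq: "p < q" "1 \<le> q" and \<nu>: "equivalent_norm \<nu>" and beta: "property_beta \<nu> p"
    and "Z \<noteq> {}" and h: "h \<in> Z \<rightarrow> lq_space q" and K: "0 \<le> K"
    and co: "co_coarsely_continuous Z dist (lq_space q) (lq_dist q) h K"
    and L: "0 < L" "\<And>x y. x \<in> Z \<Longrightarrow> y \<in> Z \<Longrightarrow> lq_dist q (h x) (h y) \<le> L * max 1 (dist x y)"
  shows False
proof -
  obtain a b where a: "0 < a" "\<And>x. a * norm x \<le> \<nu> x" and b: "0 < b" "\<And>x. \<nu> x \<le> b * norm x"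
    using \<nu> unfolding equivalent_norm_def by blast
  obtain \<gamma> where "0 < \<gamma>"
    and fork: "\<And>R \<tau> x y. 0 < R \<Longrightarrow> 0 < \<tau> \<Longrightarrow> \<nu> x \<le> R \<Longrightarrow> (\<And>i :: nat. \<nu> (y i) \<le> R) \<Longrightarrow>
      (\<And>i j. i < j \<Longrightarrow> \<tau> * R \<le> \<nu> (y i - y j)) \<Longrightarrow>
      \<exists>i. \<nu> (x - y i) \<le> 2 * R * (1 - \<gamma> * \<tau> powr p)"
    by (rule property_beta_fork[OF \<nu> beta]) blast
  obtain C0 where "0 < C0" and C0: "\<And>r x u. 1 \<le> r \<Longrightarrow> x \<in> Z \<Longrightarrow> u \<in> lq_space q \<Longrightarrow>
      lq_dist q (h x) u \<le> r \<Longrightarrow> \<exists>w\<in>Z. dist x w \<le> C0 * r \<and> lq_dist q (h w) u \<le> K"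
    using co_lipschitz_for_large_distances[OF pq(2) h K co] by metis
  define C where "C = b * C0"
  have "0 < C" using b \<open>0 < C0\<close> by (simp add: C_def)
  define \<kappa> where "\<kappa> = K + 1"
  have "0 < \<kappa>" using K by (simp add: \<kappa>_def)
  have start: "tracks \<nu> Z q h r (C * r) \<kappa>" if r: "1 \<le> r" for r
    unfolding tracks_def
  proof (intro ballI allI impI)
    fix x v N
    assume x: "x \<in> Z" and fin: "finite {i. v i \<noteq> (0::real)}" and v: "lq_norm q v \<le> r"
    have v_lq: "v \<in> lq_space q" by (rule finite_support_in_lq_space[OF fin])
    have hx: "h x \<in> lq_space q" using h x by blast
    have u: "(\<lambda>i. h x i + v i) \<in> lq_space q" (is "?u \<in> _")
      by (rule lq_space_add[OF pq(2) hx v_lq])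
    have "lq_dist q (h x) ?u \<le> r"
      using v lq_norm_scale[OF v_lq, of "-1"] pq by (simp add: lq_dist_def)
    then obtain w where w: "w \<in> Z" "dist x w \<le> C0 * r" "lq_dist q (h w) ?u \<le> K"
      using C0[OF r x u] by blast
    have "\<nu> (x - w) \<le> b * dist x w" using b(2)[of "x - w"] by (simp add: dist_norm)
    also have "\<dots> \<le> C * r" using w(2) b(1) by (simp add: C_def mult.assoc)
    finally have "\<nu> (x - w) \<le> C * r" .
    moreover have "\<bar>h w j - h x j - v j\<bar> \<le> \<kappa>" for j
    proof -
      have "h w \<in> lq_space q" using h w by blast
      from abs_coord_le_lq_norm[OF lq_space_diff[OF pq(2) this u], of j]
      have "\<bar>h w j - (h x j + v j)\<bar> \<le> lq_dist q (h w) ?u"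
        using pq by (simp add: lq_dist_def)
      then show ?thesis using w(3) unfolding \<kappa>_def by linarith
    qed
    ultimately show "\<exists>w\<in>Z. \<nu> (x - w) \<le> C * r \<and> (\<forall>j<N. \<bar>h w j - h x j - v j\<bar> \<le> \<kappa>)"
      using w(1) by blast
  qed
  define A where "A = \<gamma> * (a / (4 * L * C)) powr p"
  have "0 < A" using \<open>0 < \<gamma>\<close> a(1) L(1) \<open>0 < C\<close> by (simp add: A_def)
  then obtain t \<theta> where t: "0 < t" "t \<le> 1" and \<theta>: "0 < \<theta>" "\<theta> < 1"
    "(1 + t powr q) powr (1 / q) * (1 - A * t powr p) \<le> \<theta>"
    using gain_beats_loss[OF _ pq] by blast
  \<comment> \<open>With a detour of relative size \<open>t\<close>, lifts of length \<open>r\<close> can only advance by \<open>r / l\<close>.\<close>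
  define l where "l = (1 + t powr q) powr (1 / q)"
  have l_q: "l powr q = 1 + t powr q" using pq by (simp add: l_def powr_powr add_nonneg_nonneg)
  have "1 \<le> l" using pq by (simp add: l_def ge_one_powr_ge_zero)
  have tq: "t powr q \<le> 1" using t pq by (simp add: powr_le1)
  have "l \<le> (1 + t powr q) powr 1" unfolding l_def using pq by (intro powr_mono) auto
  then have "l \<le> 2" using tq by simp
  obtain n where n: "\<theta> ^ n < a / (4 * L * C)"
    using real_arch_pow_inv[of "a / (4 * L * C)" \<theta>] \<theta> a L \<open>0 < C\<close> by auto
  \<comment> \<open>The smallest detour, \<open>t * r0 / l\<close>, has to exceed \<open>L\<close> and all accumulated errors.\<close>
  define r0 where "r0 = (4 * 2 ^ n * \<kappa> + 4 * L + 1) * l / t"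
  have r0: "t * r0 / l = 4 * 2 ^ n * \<kappa> + 4 * L + 1"
    using t \<open>1 \<le> l\<close> by (simp add: r0_def)
  have pos: "0 < 4 * 2 ^ n * \<kappa> + 4 * L + 1" using \<open>0 < \<kappa>\<close> L(1) by (simp add: add_pos_pos)
  have "1 \<le> l / t" using t \<open>1 \<le> l\<close> by simp
  then have "(4 * 2 ^ n * \<kappa> + 4 * L + 1) * 1 \<le> (4 * 2 ^ n * \<kappa> + 4 * L + 1) * (l / t)"
    using pos by (intro mult_left_mono) auto
  then have r0_ge: "4 * 2 ^ n * \<kappa> + 4 * L + 1 \<le> r0" by (simp add: r0_def)
  have "0 < r0" using r0_ge pos by linarith
  have step: "\<exists>r\<ge>r0. tracks \<nu> Z q h r (C * \<theta> ^ k * r) (2 ^ k * \<kappa>)" if "k \<le> n" for k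
    using that
  proof (induction k)
    case 0
    have "0 < 4 * 2 ^ n * \<kappa>" using \<open>0 < \<kappa>\<close> by simp
    then have "1 \<le> r0" using r0_ge L(1) by linarith
    then show ?case using start[of r0] by auto
  next
    case (Suc k)
    then obtain r where r: "r0 \<le> r" and T: "tracks \<nu> Z q h r (C * \<theta> ^ k * r) (2 ^ k * \<kappa>)" by auto
    have "0 < r" using r \<open>0 < r0\<close> by linarith
    define s where "s = t * r / l"
    define \<tau> where "\<tau> = a * t / (4 * L * C)"
    have "t * r0 / l \<le> s"
      unfolding s_def using t r \<open>1 \<le> l\<close> by (intro divide_right_mono mult_left_mono) auto
    then have s_ge: "4 * 2 ^ n * \<kappa> + 4 * L + 1 \<le> s" using r0 by simp
    have "(2::real) ^ k \<le> 2 ^ n" using Suc.prems by (intro power_increasing) auto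
    then have "2 ^ k * \<kappa> \<le> 2 ^ n * \<kappa>" using \<open>0 < \<kappa>\<close> by (intro mult_right_mono) auto
    moreover have "0 < 2 ^ k * \<kappa>" using \<open>0 < \<kappa>\<close> by simp
    ultimately have s2: "L < s - 2 * (2 ^ k * \<kappa>)" "s / 2 \<le> s - 2 * (2 ^ k * \<kappa>)"
      using s_ge L(1) by linarith+
    have "tracks \<nu> Z q h (2 * (r / l)) (2 * (C * \<theta> ^ k * r) * (1 - \<gamma> * \<tau> powr p)) (2 * (2 ^ k * \<kappa>))"
    proof (rule tracks_double[OF pq(2) h \<nu> a L fork T _ _ _ _ s2(1)])
      show "(r / l) powr q + s powr q \<le> r powr q"
      proof -
        have "(r / l) powr q + s powr q = (r powr q + t powr q * r powr q) / (1 + t powr q)"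
          using \<open>0 < r\<close> \<open>1 \<le> l\<close> t
          by (simp add: s_def powr_divide powr_mult l_q add_divide_distrib)
        also have "r powr q + t powr q * r powr q = r powr q * (1 + t powr q)"
          by (simp add: algebra_simps)
        also have "r powr q * (1 + t powr q) / (1 + t powr q) = r powr q"
          by (intro nonzero_mult_div_cancel_right) (smt (verit) powr_ge_zero)
        finally show ?thesis by simp
      qed
      have "\<theta> ^ k \<le> 1" using \<theta> by (simp add: power_le_one)
      then have "\<tau> * (C * \<theta> ^ k * r) \<le> \<tau> * (C * 1 * r)"
        using \<open>0 < C\<close> \<open>0 < r\<close> a(1) t L(1)
        by (intro mult_left_mono mult_right_mono) (auto simp: \<tau>_def)
      also have "\<dots> = a * (t * r / 2 / 2) / L"
        using \<open>0 < C\<close> by (simp add: \<tau>_def)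
      also have "\<dots> \<le> a * (s / 2) / L"
      proof -
        have "t * r / 2 \<le> s"
          unfolding s_def using t \<open>0 < r\<close> \<open>1 \<le> l\<close> \<open>l \<le> 2\<close> by (intro divide_left_mono) auto
        then show ?thesis
          using a(1) L(1) by (intro divide_right_mono mult_left_mono) auto
      qed
      also have "\<dots> \<le> a * (s - 2 * (2 ^ k * \<kappa>)) / L"
        using s2(2) a(1) L(1) by (intro divide_right_mono mult_left_mono) auto
      finally show "\<tau> * (C * \<theta> ^ k * r) \<le> a * (s - 2 * (2 ^ k * \<kappa>)) / L" .
    qed (use \<open>0 < r\<close> \<open>0 < C\<close> \<theta> \<open>0 < \<kappa>\<close> \<open>1 \<le> l\<close> a t L(1) in \<open>auto simp: \<tau>_def\<close>)
    moreover have "2 * (C * \<theta> ^ k * r) * (1 - \<gamma> * \<tau> powr p) \<le> C * \<theta> ^ Suc k * (2 * (r / l))"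
    proof -
      have "\<tau> = a / (4 * L * C) * t" by (simp add: \<tau>_def)
      then have "\<gamma> * \<tau> powr p = A * t powr p"
        by (simp only: A_def powr_mult mult.assoc)
      then have "l * (1 - \<gamma> * \<tau> powr p) \<le> \<theta>" using \<theta>(3) by (simp add: l_def)
      then have "1 - \<gamma> * \<tau> powr p \<le> \<theta> / l" using \<open>1 \<le> l\<close> by (simp add: field_simps)
      then have "2 * (C * \<theta> ^ k * r) * (1 - \<gamma> * \<tau> powr p) \<le> 2 * (C * \<theta> ^ k * r) * (\<theta> / l)"
        using \<open>0 < C\<close> \<theta>(1) \<open>0 < r\<close> by (intro mult_left_mono) auto
      then show ?thesis by (simp add: mult_ac)
    qed
    ultimately have "tracks \<nu> Z q h (2 * (r / l)) (C * \<theta> ^ Suc k * (2 * (r / l))) (2 ^ Suc k * \<kappa>)"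
      using tracks_mono by (simp add: mult.assoc) blast
    moreover have "r0 \<le> 2 * (r / l)"
    proof -
      have "r * l \<le> r * 2" using \<open>0 < r\<close> \<open>l \<le> 2\<close> by (intro mult_left_mono) auto
      then have "r \<le> 2 * (r / l)" using \<open>1 \<le> l\<close> by (simp add: field_simps)
      then show ?thesis using r by linarith
    qed
    ultimately show ?case by blast
  qed
  obtain r where r: "r0 \<le> r" and T: "tracks \<nu> Z q h r (C * \<theta> ^ n * r) (2 ^ n * \<kappa>)"
    using step[of n] by blast
  have "0 < r" using r \<open>0 < r0\<close> by linarith
  obtain x where x: "x \<in> Z" using \<open>Z \<noteq> {}\<close> by blast
  \<comment> \<open>Moving far in the coordinate \<open>0\<close> at cost \<open>C * \<theta> ^ n * r\<close> violates the Lipschitz condition.\<close>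
  define v :: "nat \<Rightarrow> real" where "v = (\<lambda>_. 0)(0 := r)"
  have "lq_norm q v powr q = r powr q"
    using lq_norm_powr_fun_upd[of q "\<lambda>_. 0" 0 r] pq \<open>0 < r\<close>
    by (simp add: v_def lq_space_def lq_norm_def)
  then have "lq_norm q v \<le> r"
    using pq \<open>0 < r\<close> powr_less_mono2[of q r "lq_norm q v"] by fastforce
  moreover have "finite {i. v i \<noteq> 0}"
    by (rule finite_subset[of _ "{0}"]) (auto simp: v_def)
  ultimately obtain w where w: "w \<in> Z" "\<nu> (x - w) \<le> C * \<theta> ^ n * r"
      "\<And>j. j < 1 \<Longrightarrow> \<bar>h w j - h x j - v j\<bar> \<le> 2 ^ n * \<kappa>"
    using tracksE[OF T x, of v 1] by blast
  have small: "4 * (2 ^ n * \<kappa>) \<le> r" "4 * L \<le> r"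
    using r r0_ge L(1) \<open>0 < \<kappa>\<close> by (simp_all add: add_nonneg_nonneg) (smt (verit) mult_pos_pos zero_less_power)+
  have "h x \<in> lq_space q" "h w \<in> lq_space q" using h x w(1) by auto
  then have "\<bar>h x 0 - h w 0\<bar> \<le> lq_dist q (h x) (h w)"
    unfolding lq_dist_def using pq
    by (intro abs_coord_le_lq_norm[of "\<lambda>m. h x m - h w m"] lq_space_diff) auto
  moreover have "\<bar>h w 0 - h x 0 - r\<bar> \<le> 2 ^ n * \<kappa>"
    using w(3)[of 0] by (simp add: v_def)
  ultimately have far: "3 / 4 * r \<le> lq_dist q (h x) (h w)"
    using small(1) by linarith
  have "a * dist x w \<le> C * \<theta> ^ n * r"
    using a(2)[of "x - w"] w(2) by (simp add: dist_norm)
  also have "\<dots> \<le> C * (a / (4 * L * C)) * r"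
    using n \<open>0 < C\<close> \<open>0 < r\<close> by (intro mult_left_mono mult_right_mono) auto
  finally have "L * dist x w \<le> r / 4"
    using a(1) L(1) \<open>0 < C\<close> by (simp add: field_simps)
  then have "L * max 1 (dist x w) \<le> r / 4"
    using small(2) by (simp add: max_def)
  then show False
    using far L(2)[OF x w(1)] \<open>0 < r\<close> by linarith
qed

theorem theorem4p8:
  fixes Z :: "'x::banach set" and f :: "'x \<Rightarrow> 'y::banach" and p q :: real
  assumes "1 < p"
    and "\<exists>\<nu> :: 'x \<Rightarrow> real. equivalent_norm \<nu> \<and> property_beta \<nu> p"
    and "coarse_quotient_map Z dist (UNIV :: 'y set) dist f"
    and "lipschitz_for_large_distances Z dist (UNIV :: 'y set) dist f"
    and "p < q"
  shows "\<not> (\<exists>(S :: 'y set) g.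
              coarse_quotient_map S dist (lq_space q) (lq_dist q) g \<and>
              lipschitz_for_large_distances S dist (lq_space q) (lq_dist q) g)"
proof
  assume "\<exists>(S :: 'y set) g. coarse_quotient_map S dist (lq_space q) (lq_dist q) g \<and>
              lipschitz_for_large_distances S dist (lq_space q) (lq_dist q) g"
  then obtain S :: "'y set" and g where
    g: "coarse_quotient_map S dist (lq_space q) (lq_dist q) g"
      "lipschitz_for_large_distances S dist (lq_space q) (lq_dist q) g" by blast
  obtain \<nu> :: "'x \<Rightarrow> real" where \<nu>: "equivalent_norm \<nu>" "property_beta \<nu> p"
    using assms(2) by blast
  have q: "1 \<le> q" using assms(1,5) by simp
  show False
    by (rule coarse_subquotient_trans[OF Met_TC.Metric_space_axioms Met_TC.Metric_space_axioms
          Metric_space_lq[OF q] subset_UNIV subset_UNIV assms(3,4) g])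
      (rule lq_not_coarse_subquotient_of_beta[OF assms(5) q \<nu>])
qed

end
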